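(* Let $G=(V,E)$ be a connected graph on $n$ vertices and let $\boldsymbol\theta\in\mathbb{R}^n$ be a second-order stationary point of the energy function $E_G$. If the nodes $a,b\in V$ form a pair of closed twins, i.e. $N[a]=N[b]$, then $\boldsymbol v_a=\boldsymbol v_b$.
   Context: Graphs are finite and simple. $G=(V,E)$ has vertex set $V=\{1,\dots,n\}$ and adjacency matrix $A$. $N(u)=\{v\in V:\{u,v\}\in E\}$ is the open neighborhood of $u$ and $N[u]=N(u)\cup\{u\}$ the closed neighborhood. The Kuramoto energy is $E_G(\boldsymbol\theta)=\frac12\sum_{1\le i,j\le n}A_{ij}\bigl(1-\cos(\theta_i-\theta_j)\bigr)$ for $\boldsymbol\theta\in\mathbb{R}^n$. A second-order stationary point of $E_G$ is a $\boldsymbol\theta\in\mathbb{R}^n$ with $\nabla E_G(\boldsymbol\theta)=0$ and $\nabla^2E_G(\boldsymbol\theta)$ positive semidefinite. The phasor of node $i$ is $\boldsymbol v_i=(\cos\theta_i,\sin\theta_i)\in\mathbb{R}^2$. *)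

theory Defs
  imports "HOL-Analysis.Analysis" "Graph_Theory.Graph_Theory"
begin

text \<open>
  Finite simple graphs are the locale predicate \<open>pair_graph\<close> (finite, loop-free, symmetric arc
  relation). The vertex set \<open>{1, \<dots>, n}\<close> is represented by a finite type \<open>'n\<close>: statements
  assume \<open>pverts G = UNIV\<close>, so that \<open>n = CARD('n)\<close> and \<open>\<real>\<^sup>n\<close> is \<open>real ^ 'n\<close>.
\<close>

definition adjacency_matrix :: "'n pair_pre_digraph \<Rightarrow> real ^ 'n ^ 'n" where
  "adjacency_matrix G = (\<chi> i j. if (i, j) \<in> parcs G then 1 else 0)"

definition open_neighborhood :: "'n pair_pre_digraph \<Rightarrow> 'n \<Rightarrow> 'n set" where
  "open_neighborhood G u = {v \<in> pverts G. (u, v) \<in> parcs G}"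

definition closed_neighborhood :: "'n pair_pre_digraph \<Rightarrow> 'n \<Rightarrow> 'n set" where
  "closed_neighborhood G u = open_neighborhood G u \<union> {u}"

definition closed_twins :: "'n pair_pre_digraph \<Rightarrow> 'n \<Rightarrow> 'n \<Rightarrow> bool" where
  "closed_twins G a b \<longleftrightarrow> closed_neighborhood G a = closed_neighborhood G b"

definition kuramoto_energy :: "'n::finite pair_pre_digraph \<Rightarrow> real ^ 'n \<Rightarrow> real" where
  "kuramoto_energy G \<theta> =
    1 / 2 * (\<Sum>i\<in>UNIV. \<Sum>j\<in>UNIV. adjacency_matrix G $ i $ j * (1 - cos (\<theta> $ i - \<theta> $ j)))"

text \<open>
  \<open>H\<close> is the Hessian matrix of \<open>f\<close> at \<open>x\<close>: the Jacobian matrix at \<open>x\<close> of the gradient field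
  of \<open>f\<close>, which has to exist in a neighbourhood of \<open>x\<close>.
\<close>
definition has_hessian ::
  "(real ^ 'n::finite \<Rightarrow> real) \<Rightarrow> real ^ 'n ^ 'n \<Rightarrow> real ^ 'n \<Rightarrow> bool" where
  "has_hessian f H x \<longleftrightarrow>
    (\<exists>g. (\<forall>\<^sub>F y in nhds x. GDERIV f y :> g y) \<and> (g has_derivative (\<lambda>h. H *v h)) (at x))"

definition positive_semidefinite :: "real ^ 'n::finite ^ 'n \<Rightarrow> bool" where
  "positive_semidefinite M \<longleftrightarrow> transpose M = M \<and> (\<forall>x. 0 \<le> x \<bullet> (M *v x))"

definition second_order_stationary_point ::
  "(real ^ 'n::finite \<Rightarrow> real) \<Rightarrow> real ^ 'n \<Rightarrow> bool" where
  "second_order_stationary_point f x \<longleftrightarrow>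
    (GDERIV f x :> 0) \<and> (\<exists>H. has_hessian f H x \<and> positive_semidefinite H)"

definition phasor :: "real ^ 'n \<Rightarrow> 'n \<Rightarrow> real ^ 2" where
  "phasor \<theta> i = vector [cos (\<theta> $ i), sin (\<theta> $ i)]"

text \<open>
  The energy has a gradient and a symmetric Hessian everywhere, so the existential quantifiers
  above and the symmetry requirement do not restrict the second-order stationary points.
\<close>

lemma kuramoto_energy_gradient:
  fixes G :: "'n::finite pair_pre_digraph"
  assumes "pair_graph G"
  shows "GDERIV (kuramoto_energy G) \<theta> :>
    (\<chi> k. \<Sum>j\<in>UNIV. adjacency_matrix G $ k $ j * sin (\<theta> $ k - \<theta> $ j))"
proof -
  interpret pair_graph G by fact
  let ?A = "adjacency_matrix G"
  have sym: "?A $ i $ j = ?A $ j $ i" for i j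
    using arcs_symmetric[of i j] arcs_symmetric[of j i] by (auto simp: adjacency_matrix_def)
  let ?S = "\<lambda>h::real^'n. \<Sum>i\<in>UNIV. \<Sum>j\<in>UNIV. h $ i * (?A $ i $ j * sin (\<theta> $ i - \<theta> $ j))"
  have D: "(kuramoto_energy G has_derivative (\<lambda>h. 1 / 2 *
      (\<Sum>i\<in>UNIV. \<Sum>j\<in>UNIV. ?A $ i $ j * (sin (\<theta> $ i - \<theta> $ j) * (h $ i - h $ j))))) (at \<theta>)"
    unfolding kuramoto_energy_def[abs_def]
    by (auto intro!: derivative_eq_intros sum.cong ext
        bounded_linear.has_derivative[OF bounded_linear_vec_nth])
  have "(\<Sum>i\<in>UNIV. \<Sum>j\<in>UNIV. h $ j * (?A $ i $ j * sin (\<theta> $ i - \<theta> $ j))) = - ?S h"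
    for h :: "real^'n"
  proof -
    have "(\<Sum>i\<in>UNIV. \<Sum>j\<in>UNIV. h $ j * (?A $ i $ j * sin (\<theta> $ i - \<theta> $ j)))
        = (\<Sum>j\<in>UNIV. \<Sum>i\<in>UNIV. h $ j * (?A $ i $ j * sin (\<theta> $ i - \<theta> $ j)))"
      by (rule sum.swap)
    also have "\<dots> = (\<Sum>j\<in>UNIV. \<Sum>i\<in>UNIV. - (h $ j * (?A $ j $ i * sin (\<theta> $ j - \<theta> $ i))))"
    proof (intro sum.cong refl)
      fix i j :: 'n
      have "sin (\<theta> $ i - \<theta> $ j) = - sin (\<theta> $ j - \<theta> $ i)"
        by (metis minus_diff_eq sin_minus)
      then show "h $ j * (?A $ i $ j * sin (\<theta> $ i - \<theta> $ j))
          = - (h $ j * (?A $ j $ i * sin (\<theta> $ j - \<theta> $ i)))"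
        by (simp add: sym[of i j])
    qed
    also have "\<dots> = - ?S h" by (simp add: sum_negf)
    finally show ?thesis .
  qed
  moreover have "(\<Sum>i\<in>UNIV. \<Sum>j\<in>UNIV. ?A $ i $ j * (sin (\<theta> $ i - \<theta> $ j) * (h $ i - h $ j)))
      = ?S h - (\<Sum>i\<in>UNIV. \<Sum>j\<in>UNIV. h $ j * (?A $ i $ j * sin (\<theta> $ i - \<theta> $ j)))"
    for h :: "real^'n"
    by (simp add: sum_subtractf[symmetric] algebra_simps)
  moreover have "h \<bullet> (\<chi> k. \<Sum>j\<in>UNIV. ?A $ k $ j * sin (\<theta> $ k - \<theta> $ j)) = ?S h"
    for h :: "real^'n"
    by (simp add: inner_vec_def sum_distrib_left)
  ultimately show ?thesis
    using D by (simp add: gderiv_def)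
qed

lemma kuramoto_energy_hessian:
  fixes G :: "'n::finite pair_pre_digraph"
  assumes "pair_graph G"
  defines "H \<equiv> \<lambda>\<theta>. \<chi> i j.
    (if i = j then \<Sum>l\<in>UNIV. adjacency_matrix G $ i $ l * cos (\<theta> $ i - \<theta> $ l) else 0)
      - adjacency_matrix G $ i $ j * cos (\<theta> $ i - \<theta> $ j)"
  shows "has_hessian (kuramoto_energy G) (H \<theta>) \<theta>" and "transpose (H \<theta>) = H \<theta>"
proof -
  interpret pair_graph G by fact
  let ?A = "adjacency_matrix G"
  have sym: "?A $ i $ j = ?A $ j $ i" for i j
    using arcs_symmetric[of i j] arcs_symmetric[of j i] by (auto simp: adjacency_matrix_def)
  have cs: "cos (\<theta> $ i - \<theta> $ j) = cos (\<theta> $ j - \<theta> $ i)" for i j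
    by (metis minus_diff_eq cos_minus)
  show "transpose (H \<theta>) = H \<theta>"
  proof -
    have "transpose (H \<theta>) $ i $ j = H \<theta> $ i $ j" for i j
      using sym[of i j] cs[of i j] by (auto simp: H_def transpose_def)
    then show ?thesis by (simp add: vec_eq_iff)
  qed
  let ?g = "\<lambda>y::real^'n. \<chi> k. \<Sum>j\<in>UNIV. ?A $ k $ j * sin (y $ k - y $ j)"
  have Hv: "H \<theta> *v h =
      (\<chi> k. \<Sum>j\<in>UNIV. ?A $ k $ j * (cos (\<theta> $ k - \<theta> $ j) * (h $ k - h $ j)))" for h
  proof -
    have "(H \<theta> *v h) $ k = (\<Sum>l\<in>UNIV. ?A $ k $ l * cos (\<theta> $ k - \<theta> $ l)) * h $ k
        - (\<Sum>j\<in>UNIV. ?A $ k $ j * cos (\<theta> $ k - \<theta> $ j) * h $ j)" for k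
      by (simp add: H_def matrix_vector_mult_def left_diff_distrib sum_subtractf
          if_distrib[of "\<lambda>x. x * _"] cong: if_cong)
    also have "\<dots> k = (\<Sum>j\<in>UNIV. ?A $ k $ j * (cos (\<theta> $ k - \<theta> $ j) * (h $ k - h $ j)))" for k
      by (simp add: sum_distrib_right right_diff_distrib sum_subtractf mult.assoc)
    finally show ?thesis by (simp add: vec_eq_iff)
  qed
  have "(?g has_derivative (\<lambda>h. H \<theta> *v h)) (at \<theta>)"
    unfolding Hv
    by (subst has_derivative_componentwise_within)
      (auto simp: Basis_vec_def inner_axis intro!: derivative_eq_intros sum.cong ext
        bounded_linear.has_derivative[OF bounded_linear_vec_nth])
  then show "has_hessian (kuramoto_energy G) (H \<theta>) \<theta>"
    unfolding has_hessian_def using kuramoto_energy_gradient[OF assms(1)]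
    by (intro exI[of _ ?g]) auto
qed

end

theory Submission
  imports Defs
begin

text \<open>
  Let \<open>M = N[a] = N[b]\<close> and let \<open>S\<close> be the sum of the phasors \<open>v\<^sub>j\<close> over \<open>j \<in> M\<close>. The gradient
  condition at \<open>a\<close> says that the sum over the open neighborhood, \<open>S - v\<^sub>a\<close>, is parallel to \<open>v\<^sub>a\<close>,
  so \<open>S = r v\<^sub>a\<close> for a real number \<open>r\<close>. The diagonal entry of the Hessian at \<open>a\<close> is
  \<open>(S - v\<^sub>a) \<bullet> v\<^sub>a = r - 1\<close>, and positive semidefiniteness makes it nonnegative, so \<open>r \<ge> 1\<close>.
  Hence \<open>v\<^sub>a\<close> is the unit vector in the direction of \<open>S\<close>. Since \<open>b\<close> has the same closed
  neighborhood, it has the same \<open>S\<close>, and \<open>v\<^sub>b\<close> is the same unit vector.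

  Semidefiniteness is given for some Hessian matrix, whereas the diagonal entry above belongs to
  the explicit one; uniqueness of the Hessian (\<open>has_hessian_unique\<close>) identifies the two. The
  two local conditions are in \<open>stationary_phases_balance\<close> and \<open>stationary_cosine_sum_nonneg\<close>,
  and \<open>unit_vector_unique\<close> is the final step on directions.
\<close>

lemma GDERIV_unique:
  fixes f :: "'a::real_inner \<Rightarrow> real"
  assumes "GDERIV f x :> D" "GDERIV f x :> D'"
  shows "D = D'"
proof -
  have "(\<lambda>h. h \<bullet> D) = (\<lambda>h. h \<bullet> D')"
    using assms unfolding gderiv_def by (rule has_derivative_unique)
  then have "(D - D') \<bullet> D = (D - D') \<bullet> D'" by (rule fun_cong)
  then have "(D - D') \<bullet> (D - D') = 0" by (simp add: inner_diff_right)
  then show ?thesis by simp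
qed

text \<open>
  The two gradient fields agree only near \<open>x\<close>, which is enough for them to have the same
  derivative at \<open>x\<close>.
\<close>
lemma has_hessian_unique:
  assumes "has_hessian f H x" "has_hessian f H' x"
  shows "H = H'"
proof -
  obtain g where g: "\<forall>\<^sub>F y in nhds x. GDERIV f y :> g y"
    and dg: "(g has_derivative (\<lambda>h. H *v h)) (at x)"
    using assms(1) unfolding has_hessian_def by blast
  obtain g' where g': "\<forall>\<^sub>F y in nhds x. GDERIV f y :> g' y"
    and dg': "(g' has_derivative (\<lambda>h. H' *v h)) (at x)"
    using assms(2) unfolding has_hessian_def by blast
  have eq: "\<forall>\<^sub>F y in nhds x. g' y = g y"
    using g g' by eventually_elim (rule GDERIV_unique)
  then have "g' x = g x" by (rule eventually_nhds_x_imp_x)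
  moreover have "\<forall>\<^sub>F y in at x. g' y = g y"
    using eq by (simp add: eventually_nhds_conv_at)
  ultimately have "(g has_derivative (\<lambda>h. H' *v h)) (at x)"
    using has_derivative_transform_eventually[OF dg'] by simp
  then have "(\<lambda>h. H *v h) = (\<lambda>h. H' *v h)"
    using has_derivative_unique[OF dg] by blast
  then show ?thesis by (simp add: matrix_eq fun_eq_iff)
qed

lemma positive_semidefinite_diagonal_nonneg:
  assumes "positive_semidefinite M"
  shows "0 \<le> M $ k $ k"
proof -
  have "0 \<le> axis k 1 \<bullet> (M *v axis k 1)"
    using assms by (simp add: positive_semidefinite_def)
  then show ?thesis
    by (simp add: matrix_vector_mult_basis column_def inner_axis')
qed

lemma sum_adjacency_matrix:
  fixes G :: "'n::finite pair_pre_digraph"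
  assumes "pverts G = UNIV"
  shows "(\<Sum>j\<in>UNIV. adjacency_matrix G $ k $ j * f j) = (\<Sum>j\<in>open_neighborhood G k. f j)"
proof -
  have "(\<Sum>j\<in>UNIV. adjacency_matrix G $ k $ j * f j)
      = (\<Sum>j\<in>UNIV. if (k, j) \<in> parcs G then f j else 0)"
    by (intro sum.cong) (simp_all add: adjacency_matrix_def)
  also have "\<dots> = (\<Sum>j\<in>open_neighborhood G k. f j)"
    using assms by (simp add: open_neighborhood_def sum.If_cases)
  finally show ?thesis .
qed

lemma not_in_own_open_neighborhood:
  assumes "pair_graph G"
  shows "u \<notin> open_neighborhood G u"
proof -
  interpret pair_graph G by fact
  show ?thesis using no_loops[of "(u, u)"] by (auto simp: open_neighborhood_def)
qed

lemma sum_closed_neighborhood: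
  fixes G :: "'n::finite pair_pre_digraph"
  assumes "pair_graph G"
  shows "sum f (closed_neighborhood G u) = f u + sum f (open_neighborhood G u)"
  using not_in_own_open_neighborhood[OF assms, of u] by (simp add: closed_neighborhood_def)

text \<open>The gradient condition. The term \<open>j = k\<close> is \<open>sin 0\<close>, so closing the neighborhood is free.\<close>
lemma stationary_phases_balance:
  fixes G :: "'n::finite pair_pre_digraph"
  assumes "pair_graph G" "pverts G = UNIV"
    and "second_order_stationary_point (kuramoto_energy G) \<theta>"
  shows "(\<Sum>j\<in>closed_neighborhood G k. sin (\<theta> $ k - \<theta> $ j)) = 0"
proof -
  have "(\<chi> k. \<Sum>j\<in>UNIV. adjacency_matrix G $ k $ j * sin (\<theta> $ k - \<theta> $ j)) = 0"
    using kuramoto_energy_gradient[OF assms(1)] assms(3)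
    unfolding second_order_stationary_point_def by (blast intro: GDERIV_unique)
  then have "(\<Sum>j\<in>UNIV. adjacency_matrix G $ k $ j * sin (\<theta> $ k - \<theta> $ j)) = 0"
    by (simp add: vec_eq_iff)
  then show ?thesis
    by (simp add: sum_adjacency_matrix[OF assms(2)] sum_closed_neighborhood[OF assms(1)])
qed

text \<open>
  The left-hand side is the second derivative of the energy when the phase of the single node \<open>k\<close>
  moves, that is, the diagonal entry of the Hessian at \<open>k\<close>.
\<close>
lemma stationary_cosine_sum_nonneg:
  fixes G :: "'n::finite pair_pre_digraph"
  assumes "pair_graph G" "pverts G = UNIV"
    and "second_order_stationary_point (kuramoto_energy G) \<theta>"
  shows "0 \<le> (\<Sum>j\<in>open_neighborhood G k. cos (\<theta> $ k - \<theta> $ j))"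
proof -
  let ?H = "\<chi> i j. (if i = j then \<Sum>l\<in>UNIV. adjacency_matrix G $ i $ l * cos (\<theta> $ i - \<theta> $ l) else 0)
      - adjacency_matrix G $ i $ j * cos (\<theta> $ i - \<theta> $ j)"
  have "positive_semidefinite ?H"
    using assms(3) has_hessian_unique[OF _ kuramoto_energy_hessian(1)[OF assms(1)]]
    unfolding second_order_stationary_point_def by blast
  then have "0 \<le> ?H $ k $ k" by (rule positive_semidefinite_diagonal_nonneg)
  moreover have "adjacency_matrix G $ k $ k = 0"
    using not_in_own_open_neighborhood[OF assms(1), of k] assms(2)
    by (simp add: adjacency_matrix_def open_neighborhood_def)
  ultimately show ?thesis
    by (simp add: sum_adjacency_matrix[OF assms(2)])
qed

text \<open>
  The closed neighborhood sum of phasors is \<open>S = (C, D)\<close>. The balance condition says that \<open>S\<close> has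
  no component orthogonal to the phasor of \<open>k\<close>; the node \<open>k\<close> itself contributes \<open>1\<close> to the
  component along it, which turns the weak inequality of the Hessian into \<open>r > 0\<close>.
\<close>
lemma stationary_phasor_sum:
  fixes G :: "'n::finite pair_pre_digraph" and k :: 'n
  assumes "pair_graph G" "pverts G = UNIV"
    and "second_order_stationary_point (kuramoto_energy G) \<theta>"
  defines "C \<equiv> \<Sum>j\<in>closed_neighborhood G k. cos (\<theta> $ j)"
    and "D \<equiv> \<Sum>j\<in>closed_neighborhood G k. sin (\<theta> $ j)"
  obtains r where "r > 0" "C = r * cos (\<theta> $ k)" "D = r * sin (\<theta> $ k)"
proof
  let ?c = "cos (\<theta> $ k)" and ?s = "sin (\<theta> $ k)"
  let ?r = "C * ?c + D * ?s"
  have orth: "?s * C = ?c * D"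
    using stationary_phases_balance[OF assms(1-3), of k]
    by (simp add: C_def D_def sin_diff sum_subtractf sum_distrib_left)
  have "?r = (\<Sum>j\<in>closed_neighborhood G k. cos (\<theta> $ k - \<theta> $ j))"
    by (simp add: C_def D_def cos_diff sum.distrib sum_distrib_left mult.commute)
  also have "\<dots> = 1 + (\<Sum>j\<in>open_neighborhood G k. cos (\<theta> $ k - \<theta> $ j))"
    by (simp add: sum_closed_neighborhood[OF assms(1)])
  finally show "?r > 0"
    using stationary_cosine_sum_nonneg[OF assms(1-3), of k] by simp
  have pyth: "?c * ?c + ?s * ?s = 1"
    using sin_cos_squared_add[of "\<theta> $ k"] by (simp add: power2_eq_square)
  show "C = ?r * ?c" using orth pyth by algebra
  show "D = ?r * ?s" using orth pyth by algebra
qed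

lemma unit_vector_unique:
  fixes r s t u :: real
  assumes "r > 0" "s > 0"
    and "r * cos t = s * cos u" "r * sin t = s * sin u"
  shows "cos t = cos u \<and> sin t = sin u"
proof -
  have "(r * cos t)\<^sup>2 + (r * sin t)\<^sup>2 = (s * cos u)\<^sup>2 + (s * sin u)\<^sup>2"
    using assms(3,4) by simp
  then have "r\<^sup>2 = s\<^sup>2"
    by (simp add: power_mult_distrib flip: distrib_left)
  then have "r = s" using assms(1,2) by (simp add: power2_eq_iff)
  then show ?thesis using assms by simp
qed

theorem corollary5p4:
  fixes G :: "'n::finite pair_pre_digraph"
    and \<theta> :: "real ^ 'n"
    and a b :: 'n
  assumes "pair_graph G"
    and "pverts G = UNIV"
    and "Digraph_Component.connected (with_proj G)"
    and "second_order_stationary_point (kuramoto_energy G) \<theta>"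
    and "closed_twins G a b"
  shows "phasor \<theta> a = phasor \<theta> b"
proof -
  have twins: "closed_neighborhood G b = closed_neighborhood G a"
    using assms(5) by (simp add: closed_twins_def)
  obtain r where r: "r > 0"
    "(\<Sum>j\<in>closed_neighborhood G a. cos (\<theta> $ j)) = r * cos (\<theta> $ a)"
    "(\<Sum>j\<in>closed_neighborhood G a. sin (\<theta> $ j)) = r * sin (\<theta> $ a)"
    using stationary_phasor_sum[OF assms(1,2,4)] .
  obtain s where s: "s > 0"
    "(\<Sum>j\<in>closed_neighborhood G a. cos (\<theta> $ j)) = s * cos (\<theta> $ b)"
    "(\<Sum>j\<in>closed_neighborhood G a. sin (\<theta> $ j)) = s * sin (\<theta> $ b)"
    using stationary_phasor_sum[OF assms(1,2,4), of b, unfolded twins] .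
  show ?thesis
    using unit_vector_unique[of r s "\<theta> $ a" "\<theta> $ b"] r s by (simp add: phasor_def)
qed

end
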